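(* Let $P$ and $\widetilde{P}$ be probability measures on a measurable space $(\Omega,\mathcal{F})$ and let $F:\Omega\to\overline{\mathbb{R}}$. (1) Let $\mathcal{G}$ be a sub sigma-algebra of $\mathcal{F}$ and let $F\in L^1(\widetilde P)$ be $\mathcal{G}$-measurable. Then, for each of the two choices of sign, $$\pm E_{\widetilde P}[F]\leq \inf_{c>0}\left\{\frac{1}{c} \Lambda_{P}^{F}(\pm c)+\frac{1}{c} R(\widetilde P|_{\mathcal{G}}\|P|_{\mathcal{G}})\right\} =\inf_{\eta>0}\left\{\eta \Lambda_{P}^{F}(\pm \eta^{-1})+\eta R(\widetilde P|_{\mathcal{G}}\|P|_{\mathcal{G}})\right\},$$ where $-\infty+\infty$ is interpreted as $\infty$. The objective function $c\mapsto \frac{1}{c} \Lambda_{P}^{F}(\pm c)+\frac{1}{c} R(\widetilde P|_{\mathcal{G}}\|P|_{\mathcal{G}})$ (on $c>0$) is quasiconvex and the objective function $\eta\mapsto \eta \Lambda_{P}^{F}(\pm \eta^{-1})+\eta R(\widetilde P|_{\mathcal{G}}\|P|_{\mathcal{G}})$ (on $\eta>0$) is convex. (2) If $\mathcal{G}\subset\mathcal{H}\subset\mathcal{F}$ are sub sigma-algebras then $$R(\widetilde{P}|_{\mathcal{G}}\|P|_{\mathcal{G}})\leq R(\widetilde{P}|_{\mathcal{H}}\|P|_{\mathcal{H}})\leq R(\widetilde{P}\|P).$$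
   Context: $\overline{\mathbb{R}}$ denotes the extended real line $[-\infty,\infty]$. $E_Q$ is expectation under the probability measure $Q$, and $Q|_{\mathcal{G}}$ is the restriction of $Q$ to the sub sigma-algebra $\mathcal{G}$. The cumulant generating function of $F$ under $P$ is $\Lambda_P^F(c)=\log E_P[e^{cF}]\in[-\infty,\infty]$, where $\log$ is the natural logarithm and the continuous extensions of $\exp$ to $\overline{\mathbb{R}}$ and of $\log$ to $[0,\infty]$ are used. The relative entropy is $R(\widetilde P\|P)=E_{\widetilde P}[\log(d\widetilde P/dP)]$ if $\widetilde P\ll P$, and $+\infty$ otherwise. A formula with $\pm$ stands for two formulas, one with all upper signs and one with all lower signs. *)

theory Defs
  imports "HOL-Probability.Probability"
begin

definition ext_exp :: "ereal \<Rightarrow> ennreal" where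
  "ext_exp x = (if x = \<infinity> then \<infinity> else if x = -\<infinity> then 0 else ennreal (exp (real_of_ereal x)))"

definition ext_ln :: "ennreal \<Rightarrow> ereal" where
  "ext_ln x = (if x = \<infinity> then \<infinity> else if x = 0 then -\<infinity> else ereal (ln (enn2real x)))"

(* \<open>e2ennreal\<close> sends negative values to 0, so the two terms are the integrals of the positive and
   of the negative part.  Unlike the Bochner integral, this keeps the values \<infinity> and -\<infinity>. *)
definition ext_expectation :: "'a measure \<Rightarrow> ('a \<Rightarrow> ereal) \<Rightarrow> ereal" where
  "ext_expectation M F =
     enn2ereal (\<integral>\<^sup>+ x. e2ennreal (F x) \<partial>M) - enn2ereal (\<integral>\<^sup>+ x. e2ennreal (- F x) \<partial>M)"

definition ext_integrable :: "'a measure \<Rightarrow> ('a \<Rightarrow> ereal) \<Rightarrow> bool" where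
  "ext_integrable M F \<longleftrightarrow>
     F \<in> borel_measurable M \<and> (\<integral>\<^sup>+ x. e2ennreal \<bar>F x\<bar> \<partial>M) < \<infinity>"

definition cumulant_gf :: "'a measure \<Rightarrow> ('a \<Rightarrow> ereal) \<Rightarrow> real \<Rightarrow> ereal" where
  "cumulant_gf P F c = ext_ln (\<integral>\<^sup>+ x. ext_exp (ereal c * F x) \<partial>P)"

(* \<open>KL_divergence\<close> is real-valued: it is a Bochner integral, hence 0 where the relative entropy
   is infinite.  The order of arguments here is that of R(Q || P); \<open>P\<close> and \<open>Q\<close> are meant
   to live on the same sigma-algebra. *)
definition relative_entropy :: "'a measure \<Rightarrow> 'a measure \<Rightarrow> ereal" where
  "relative_entropy Q P =
     (if absolutely_continuous P Q then ext_expectation Q (\<lambda>x. ext_ln (RN_deriv P Q x)) else \<infinity>)"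

definition ext_convex_on :: "'a::real_vector set \<Rightarrow> ('a \<Rightarrow> ereal) \<Rightarrow> bool" where
  "ext_convex_on S f \<longleftrightarrow> convex S \<and>
     (\<forall>x\<in>S. \<forall>y\<in>S. \<forall>u\<ge>0. \<forall>v\<ge>0. u + v = 1 \<longrightarrow>
        f (u *\<^sub>R x + v *\<^sub>R y) \<le> ereal u * f x + ereal v * f y)"

definition ext_quasiconvex_on :: "'a::real_vector set \<Rightarrow> ('a \<Rightarrow> ereal) \<Rightarrow> bool" where
  "ext_quasiconvex_on S f \<longleftrightarrow> convex S \<and>
     (\<forall>x\<in>S. \<forall>y\<in>S. \<forall>u\<ge>0. \<forall>v\<ge>0. u + v = 1 \<longrightarrow>
        f (u *\<^sub>R x + v *\<^sub>R y) \<le> max (f x) (f y))"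

end

theory Submission
  imports Defs
begin

text \<open>
  Everything about relative entropy rests on one Gibbs-type inequality (\<open>gibbs_inequality\<close>): if \<open>Q\<close>
  is absolutely continuous with respect to \<open>P\<close> with density \<open>D\<close>, and \<open>Y\<close> is nonnegative with
  \<open>P\<close>-integral at most 1, then the \<open>Q\<close>-mean of \<open>ln Y\<close> is at most the \<open>Q\<close>-mean of \<open>ln D\<close>, which is
  the relative entropy. Indeed \<open>ln Y - ln D \<le> Y / D - 1\<close>, and \<open>Y / D\<close> has \<open>Q\<close>-mean at most 1.

  Two choices of \<open>Y\<close> give the two statements about entropy. The exponential tilt
  \<open>Y = exp (c * X) / Z\<close>, where \<open>Z\<close> is the \<open>P\<close>-mean of \<open>exp (c * X)\<close>, gives the Donsker-Varadhan bound
  \<open>c * E X \<le> ln Z + R\<close> for every real \<open>c\<close> (\<open>donsker_varadhan_inequality\<close>). Applied on \<open>G\<close> with \<open>s * c\<close>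
  in place of \<open>c\<close> and divided by \<open>c > 0\<close>, it is the bound on \<open>s * E F\<close>. The density of the
  restrictions to a sub sigma-algebra gives monotonicity of the relative entropy
  (\<open>relative_entropy_restr_to_subalg_le\<close>).

  For the shape of the objective functions, Hoelder's inequality makes the cumulant generating
  function convex on each side of 0 (\<open>cumulant_gf_convex\<close>); a perspective
  \<open>\<eta> * L (inverse \<eta>)\<close> of a convex function is convex, and so is its sum with the linear term
  \<open>\<eta> * R\<close> (\<open>ext_convex_on_perspective\<close>). The substitution \<open>c = inverse \<eta>\<close> maps intervals to
  intervals, so it turns convexity into quasiconvexity (\<open>ext_quasiconvex_on_reciprocal\<close>) and it leaves
  the infimum unchanged.
\<close>

section \<open>The Gibbs inequality\<close>

lemma measurable_ext_exp [measurable]: "ext_exp \<in> borel_measurable borel"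
  unfolding ext_exp_def[abs_def] by measurable

lemma measurable_ext_ln [measurable]: "ext_ln \<in> borel_measurable borel"
  unfolding ext_ln_def[abs_def] by measurable

text \<open>
  This is \<open>ln y - ln d \<le> y / d - 1\<close>, arranged so that only nonnegative quantities occur. In this form
  it can be integrated over positive and negative parts before anything is known to be finite.
\<close>
lemma pos_neg_parts_ext_ln_le:
  assumes "0 < d" "d < \<infinity>" "y < (\<infinity>::ennreal)"
  shows "e2ennreal (ext_ln y) + e2ennreal (- ext_ln d) + 1
           \<le> e2ennreal (- ext_ln y) + e2ennreal (ext_ln d) + y / d"
proof (cases "y = 0")
  case True
  then show ?thesis by (simp add: ext_ln_def)
next
  case False
  obtain a where a: "d = ennreal a" "0 < a" using assms by (cases d) auto
  obtain b where b: "y = ennreal b" "0 < b" using assms False by (cases y) auto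
  have "ln b - ln a \<le> b / a - 1"
    using ln_le_minus_one[of "b / a"] a b by (simp add: ln_div)
  then have "max 0 (ln b) + max 0 (- ln a) + 1 \<le> max 0 (- ln b) + max 0 (ln a) + b / a"
    by (auto simp: max_def)
  then have "ennreal (max 0 (ln b)) + ennreal (max 0 (- ln a)) + ennreal 1
      \<le> ennreal (max 0 (- ln b)) + ennreal (max 0 (ln a)) + ennreal (b / a)"
    using a b by (simp add: ennreal_plus[symmetric] ennreal_leI
      del: ennreal_plus ennreal_max_0 ennreal_max_0' ennreal_1)
  then show ?thesis
    using a b by (simp add: ext_ln_def divide_ennreal)
qed

text \<open>
  The next two bounds provide the finiteness under which the integrated inequality can be turned back
  into one between differences.
\<close>
lemma pos_part_ext_ln_le:
  assumes "0 < d" "d < \<infinity>" "y < (\<infinity>::ennreal)"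
  shows "e2ennreal (ext_ln y) \<le> e2ennreal (ext_ln d) + y / d"
proof (cases "y = 0")
  case True
  then show ?thesis by (simp add: ext_ln_def e2ennreal_neg)
next
  case False
  obtain a where a: "d = ennreal a" "0 < a" using assms by (cases d) auto
  obtain b where b: "y = ennreal b" "0 < b" using assms False by (cases y) auto
  have "ln b - ln a \<le> b / a - 1"
    using ln_le_minus_one[of "b / a"] a b by (simp add: ln_div)
  moreover have "0 \<le> b / a" using a b by simp
  ultimately have "max 0 (ln b) \<le> max 0 (ln a) + b / a"
    by (auto simp: max_def)
  then have "ennreal (max 0 (ln b)) \<le> ennreal (max 0 (ln a)) + ennreal (b / a)"
    using a b by (simp add: ennreal_plus[symmetric] ennreal_leI
      del: ennreal_plus ennreal_max_0 ennreal_max_0')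
  then show ?thesis
    using a b by (simp add: ext_ln_def divide_ennreal)
qed

lemma neg_part_ext_ln_le:
  assumes "0 < d" "d < (\<infinity>::ennreal)"
  shows "e2ennreal (- ext_ln d) \<le> 1 / d"
proof -
  obtain a where a: "d = ennreal a" "0 < a" using assms by (cases d) auto
  have "- ln a \<le> 1 / a"
    using ln_le_minus_one[of "1 / a"] a by (simp add: ln_div)
  then show ?thesis
    using a by (simp add: ext_ln_def divide_ennreal ennreal_leI flip: ennreal_1)
qed

lemma gibbs_inequality:
  assumes "prob_space P" "prob_space Q" and sets: "sets Q = sets P"
    and ac: "absolutely_continuous P Q"
    and Y [measurable]: "Y \<in> borel_measurable P" and Y1: "(\<integral>\<^sup>+ x. Y x \<partial>P) \<le> 1"
  shows "ext_expectation Q (\<lambda>x. ext_ln (Y x)) \<le> relative_entropy Q P"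
proof -
  interpret P: prob_space P by fact
  interpret Q: prob_space Q by fact
  define D where "D = RN_deriv P Q"
  have D [measurable]: "D \<in> borel_measurable P" by (simp add: D_def)
  have dens: "density P D = Q"
    unfolding D_def by (rule P.density_RN_deriv[OF ac sets])
  have [measurable_cong]: "sets Q = sets P" by (fact sets)
  have Dpos: "AE x in Q. 0 < D x"
    unfolding dens[symmetric] by (subst AE_density) (auto simp: zero_less_iff_neq_zero)
  have "(\<integral>\<^sup>+ x. D x \<partial>P) = 1"
    using Q.emeasure_space_1 unfolding dens[symmetric]
    by (simp add: emeasure_density cong: nn_integral_cong)
  then have "AE x in P. D x \<noteq> \<infinity>"
    by (intro nn_integral_PInf_AE) auto
  then have Dfin: "AE x in Q. D x < \<infinity>"
    using absolutely_continuous_AE[OF sets ac] by (auto simp: less_top)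
  have "AE x in P. Y x \<noteq> \<infinity>"
    using Y1 by (intro nn_integral_PInf_AE) (auto simp: top_unique)
  then have Yfin: "AE x in Q. Y x < \<infinity>"
    using absolutely_continuous_AE[OF sets ac] by (auto simp: less_top)
  \<comment> \<open>only an inequality, since \<open>Z\<close> may carry \<open>P\<close>-mass where \<open>D\<close> vanishes\<close>
  have ratio: "(\<integral>\<^sup>+ x. Z x / D x \<partial>Q) \<le> (\<integral>\<^sup>+ x. Z x \<partial>P)"
    if [measurable]: "Z \<in> borel_measurable P" for Z
  proof -
    have "(\<integral>\<^sup>+ x. Z x / D x \<partial>Q) = (\<integral>\<^sup>+ x. D x * (Z x / D x) \<partial>P)"
      unfolding dens[symmetric] by (rule nn_integral_density) measurable
    also have "\<dots> \<le> (\<integral>\<^sup>+ x. Z x \<partial>P)"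
    proof (rule nn_integral_mono)
      fix x show "D x * (Z x / D x) \<le> Z x"
        by (cases "D x = 0 \<or> D x = \<top>") (auto simp: ennreal_times_divide ennreal_mult_divide_eq mult.commute[of "D x"])
    qed
    finally show ?thesis .
  qed
  define Yp Yn Dp Dn W where parts:
    "Yp = (\<integral>\<^sup>+ x. e2ennreal (ext_ln (Y x)) \<partial>Q)" "Yn = (\<integral>\<^sup>+ x. e2ennreal (- ext_ln (Y x)) \<partial>Q)"
    "Dp = (\<integral>\<^sup>+ x. e2ennreal (ext_ln (D x)) \<partial>Q)" "Dn = (\<integral>\<^sup>+ x. e2ennreal (- ext_ln (D x)) \<partial>Q)"
    "W = (\<integral>\<^sup>+ x. Y x / D x \<partial>Q)"
  have W: "W \<le> 1" unfolding parts using ratio[OF Y] Y1 by (rule order_trans)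
  have "Dn \<le> (\<integral>\<^sup>+ x. 1 / D x \<partial>Q)" unfolding parts
    by (intro nn_integral_mono_AE) (use Dpos Dfin in eventually_elim, rule neg_part_ext_ln_le, auto)
  also have "\<dots> \<le> 1" using ratio[of "\<lambda>_. 1"] by (simp add: P.emeasure_space_1)
  finally have Dn: "Dn \<le> 1" .
  have "Yp \<le> (\<integral>\<^sup>+ x. e2ennreal (ext_ln (D x)) + Y x / D x \<partial>Q)" unfolding parts
    by (intro nn_integral_mono_AE) (use Dpos Dfin Yfin in eventually_elim, rule pos_part_ext_ln_le, auto)
  also have "\<dots> = Dp + W" unfolding parts by (rule nn_integral_add) measurable
  finally have Yp: "Yp \<le> Dp + W" .
  have "(\<integral>\<^sup>+ x. e2ennreal (ext_ln (Y x)) + e2ennreal (- ext_ln (D x)) + 1 \<partial>Q)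
      \<le> (\<integral>\<^sup>+ x. e2ennreal (- ext_ln (Y x)) + e2ennreal (ext_ln (D x)) + Y x / D x \<partial>Q)"
    by (intro nn_integral_mono_AE) (use Dpos Dfin Yfin in eventually_elim, rule pos_neg_parts_ext_ln_le, auto)
  then have "Yp + Dn + 1 \<le> Yn + Dp + W"
    unfolding parts by (simp add: nn_integral_add Q.emeasure_space_1)
  also have "\<dots> \<le> Yn + Dp + 1" using W by (rule add_left_mono)
  finally have main: "Yp + Dn \<le> Yn + Dp" by (simp add: add.commute[of _ 1])
  have "enn2ereal Yp - enn2ereal Yn \<le> enn2ereal Dp - enn2ereal Dn"
    \<comment> \<open>for finite \<open>Dp\<close> only \<open>Yn\<close> can be infinite, which makes the left-hand side \<open>-\<infinity>\<close>\<close>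
  proof (cases "Dp = \<infinity>")
    case True
    then show ?thesis using Dn by simp
  next
    case False
    then obtain dp dn yp where r: "Dp = ennreal dp" "Dn = ennreal dn" "Yp = ennreal yp" "dp \<ge> 0" "dn \<ge> 0" "yp \<ge> 0"
      using Dn Yp W by (cases Dp; cases Dn; cases Yp; auto simp: top_unique add_top)
    show ?thesis
    proof (cases Yn)
      case (real yn)
      then show ?thesis using main r
        by (simp add: ennreal_plus[symmetric] del: ennreal_plus) 
    next
      case top
      then show ?thesis using r by simp
    qed
  qed
  then show ?thesis
    using ac unfolding relative_entropy_def ext_expectation_def parts D_def by simp
qed


section \<open>The Donsker-Varadhan inequality\<close>

lemma ext_integrable_obtain_real:
  assumes "ext_integrable M F"
  obtains f where "integrable M f" "AE x in M. F x = ereal (f x)"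
proof
  have [measurable]: "F \<in> borel_measurable M" and fin: "(\<integral>\<^sup>+ x. e2ennreal \<bar>F x\<bar> \<partial>M) < \<infinity>"
    using assms by (auto simp: ext_integrable_def)
  have "AE x in M. e2ennreal \<bar>F x\<bar> \<noteq> \<infinity>"
    using fin by (intro nn_integral_PInf_AE) auto
  then show eq: "AE x in M. F x = ereal (real_of_ereal (F x))"
  proof eventually_elim
    case (elim x)
    then show ?case by (cases "F x") auto
  qed
  have "(\<integral>\<^sup>+ x. ennreal (norm (real_of_ereal (F x))) \<partial>M) = (\<integral>\<^sup>+ x. e2ennreal \<bar>F x\<bar> \<partial>M)"
  proof (rule nn_integral_cong_AE, use eq in eventually_elim)
    fix x assume "F x = ereal (real_of_ereal (F x))"
    then show "ennreal (norm (real_of_ereal (F x))) = e2ennreal \<bar>F x\<bar>"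
      by (cases "F x") auto
  qed
  with fin show "integrable M (\<lambda>x. real_of_ereal (F x))"
    by (intro integrableI_bounded) auto
qed

lemma ext_expectation_eq_integral:
  assumes f: "integrable M f" and eq: "AE x in M. F x = ereal (f x)"
  shows "ext_expectation M F = ereal (\<integral>x. f x \<partial>M)"
proof -
  have "(\<integral>\<^sup>+ x. e2ennreal (F x) \<partial>M) = (\<integral>\<^sup>+ x. ennreal (f x) \<partial>M)"
    by (rule nn_integral_cong_AE, use eq in eventually_elim) simp
  moreover have "(\<integral>\<^sup>+ x. e2ennreal (- F x) \<partial>M) = (\<integral>\<^sup>+ x. ennreal (- f x) \<partial>M)"
    by (rule nn_integral_cong_AE, use eq in eventually_elim) simp
  moreover have "(\<integral>\<^sup>+ x. ennreal (f x) \<partial>M) \<noteq> \<infinity>" "(\<integral>\<^sup>+ x. ennreal (- f x) \<partial>M) \<noteq> \<infinity>"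
    using f by (auto simp: real_integrable_def)
  ultimately show ?thesis
    unfolding ext_expectation_def real_lebesgue_integral_def[OF f]
    by (cases "\<integral>\<^sup>+ x. ennreal (f x) \<partial>M"; cases "\<integral>\<^sup>+ x. ennreal (- f x) \<partial>M") auto
qed

text \<open>
  The Gibbs inequality for the exponential tilt of \<open>P\<close> by \<open>c * X\<close>. If \<open>Z = 0\<close>, then \<open>c * X = -\<infinity>\<close>
  holds \<open>P\<close>-almost surely, and since \<open>X\<close> is \<open>Q\<close>-integrable this rules out absolute continuity;
  the right-hand side is then \<open>-\<infinity> + \<infinity> = \<infinity>\<close>.
\<close>
lemma donsker_varadhan_inequality:
  assumes "prob_space P" "prob_space Q" and sets: "sets Q = sets P"
    and X [measurable]: "X \<in> borel_measurable P" and int: "ext_integrable Q X"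
  shows "ereal c * ext_expectation Q X \<le> cumulant_gf P X c + relative_entropy Q P"
proof -
  interpret P: prob_space P by fact
  interpret Q: prob_space Q by fact
  obtain f where f: "integrable Q f" and Xf: "AE x in Q. X x = ereal (f x)"
    using int by (rule ext_integrable_obtain_real)
  have E: "ext_expectation Q X = ereal (\<integral>x. f x \<partial>Q)"
    using f Xf by (rule ext_expectation_eq_integral)
  define Z where "Z = (\<integral>\<^sup>+ x. ext_exp (ereal c * X x) \<partial>P)"
  have L: "cumulant_gf P X c = ext_ln Z" by (simp add: cumulant_gf_def Z_def)
  show ?thesis
  proof (cases "absolutely_continuous P Q")
    case False
    then show ?thesis by (simp add: relative_entropy_def)
  next
    case ac: True
    have "Z \<noteq> 0"
    proof
      assume "Z = 0"
      then have "AE x in P. ext_exp (ereal c * X x) = 0"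
        unfolding Z_def by (subst (asm) nn_integral_0_iff_AE) auto
      then have "AE x in Q. ext_exp (ereal c * X x) = 0"
        by (rule absolutely_continuous_AE[OF sets ac])
      with Xf have "AE x in Q. False"
        by eventually_elim (simp add: ext_exp_def)
      then show False by simp
    qed
    show ?thesis
    proof (cases "Z = \<infinity>")
      case True
      then show ?thesis by (simp add: L ext_ln_def)
    next
      case False
      with \<open>Z \<noteq> 0\<close> obtain z where z: "Z = ennreal z" "0 < z" by (cases Z) auto
      let ?Y = "\<lambda>x. ext_exp (ereal c * X x) / Z"
      have "(\<integral>\<^sup>+ x. ?Y x \<partial>P) = Z / Z"
        unfolding Z_def by (rule nn_integral_divide) measurable
      also have "\<dots> = 1" using z by (simp add: ennreal_divide_self)
      finally have "ext_expectation Q (\<lambda>x. ext_ln (?Y x)) \<le> relative_entropy Q P"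
        using ac by (intro gibbs_inequality assms) auto
      moreover have "ext_expectation Q (\<lambda>x. ext_ln (?Y x)) = ereal (\<integral>x. c * f x - ln z \<partial>Q)"
      proof (rule ext_expectation_eq_integral)
        show "integrable Q (\<lambda>x. c * f x - ln z)" using f by simp
        show "AE x in Q. ext_ln (?Y x) = ereal (c * f x - ln z)"
          using Xf
        proof eventually_elim
          case (elim x)
          with z show ?case
            by (simp add: ext_exp_def ext_ln_def divide_ennreal ln_div)
        qed
      qed
      moreover have "(\<integral>x. c * f x - ln z \<partial>Q) = c * (\<integral>x. f x \<partial>Q) - ln z"
        using f by (simp add: Q.prob_space)
      ultimately show ?thesis
        using z by (cases "relative_entropy Q P") (auto simp: L E ext_ln_def)
    qed
  qed
qed

section \<open>Convexity of the objective functions\<close>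

lemma ext_exp_eq_0_cong_sign:
  assumes "0 < c * d"
  shows "ext_exp (ereal c * x) = 0 \<longleftrightarrow> ext_exp (ereal d * x) = 0"
  using assms by (cases x) (auto simp: ext_exp_def zero_less_mult_iff)

text \<open>
  Convexity of the exponential function at the points \<open>c * x - a\<close> and \<open>d * x - b\<close>. With \<open>a\<close> and \<open>b\<close> the
  values of the cumulant generating function at \<open>c\<close> and \<open>d\<close>, the right-hand side integrates to 1; this
  is the usual derivation of Hoelder's inequality from Young's. The common sign of \<open>c\<close> and \<open>d\<close> makes
  all three exponents equal when \<open>x\<close> is infinite.
\<close>
lemma ext_exp_convex_normalized:
  assumes t: "0 < t" "t < 1" and sgn: "0 < c * d"
  shows "ext_exp (ereal (t * c + (1 - t) * d) * x) * ennreal (exp (- (t * a + (1 - t) * b)))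
    \<le> ennreal (t * exp (- a)) * ext_exp (ereal c * x) + ennreal ((1 - t) * exp (- b)) * ext_exp (ereal d * x)"
proof (cases x)
  case (real r)
  have "exp ((1 - t) *\<^sub>R (d * r - b) + t *\<^sub>R (c * r - a))
      \<le> (1 - t) * exp (d * r - b) + t * exp (c * r - a)"
    using t by (intro convex_onD[OF exp_convex]) auto
  then have "exp ((t * c + (1 - t) * d) * r) * exp (- (t * a + (1 - t) * b))
      \<le> t * exp (- a) * exp (c * r) + (1 - t) * exp (- b) * exp (d * r)"
    by (simp add: exp_add[symmetric] exp_diff exp_minus algebra_simps divide_simps)
  then show ?thesis
    using t real by (simp add: ext_exp_def ennreal_mult[symmetric] ennreal_plus[symmetric] ennreal_leI del: ennreal_plus)
next
  case PInf
  have "0 < c \<and> 0 < d \<or> c < 0 \<and> d < 0" using sgn by (auto simp: zero_less_mult_iff)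
  then show ?thesis
  proof
    assume "c < 0 \<and> d < 0"
    then have "t * c + (1 - t) * d < 0" using t by (simp add: add_neg_neg mult_pos_neg)
    then show ?thesis using PInf by (simp add: ext_exp_def)
  qed (use t PInf in \<open>simp add: ext_exp_def ennreal_mult_top\<close>)
next
  case MInf
  have "0 < c \<and> 0 < d \<or> c < 0 \<and> d < 0" using sgn by (auto simp: zero_less_mult_iff)
  then show ?thesis
  proof
    assume "0 < c \<and> 0 < d"
    then have "0 < t * c + (1 - t) * d" using t by (simp add: add_pos_pos)
    then show ?thesis using MInf by (simp add: ext_exp_def)
  qed (use t MInf in \<open>simp add: ext_exp_def ennreal_mult_top\<close>)
qed

lemma ext_ln_le_ereal:
  assumes "y \<le> ennreal (exp r)"
  shows "ext_ln y \<le> ereal r"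
proof (cases "y = 0")
  case False
  with assms obtain a where a: "y = ennreal a" "0 < a" by (cases y) (auto simp: top_unique)
  with assms have "ln a \<le> ln (exp r)" by (intro ln_mono) auto
  with a show ?thesis by (simp add: ext_ln_def)
qed (simp add: ext_ln_def)

text \<open>
  The hypothesis on the sign of \<open>c * d\<close> also settles the value \<open>-\<infinity>\<close>: if it is attained at \<open>c\<close>, then
  \<open>c * F = -\<infinity>\<close> almost surely, so it is attained everywhere on the same side of 0.
\<close>
lemma cumulant_gf_convex:
  assumes F [measurable]: "F \<in> borel_measurable P"
    and t: "0 < t" "t < 1" and sgn: "0 < c * d"
  shows "cumulant_gf P F (t * c + (1 - t) * d)
    \<le> ereal t * cumulant_gf P F c + ereal (1 - t) * cumulant_gf P F d"
proof -
  define e where "e = t * c + (1 - t) * d"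
  have ec: "0 < c * e" and ed: "0 < d * e"
    using t sgn unfolding e_def
    by (auto simp: zero_less_mult_iff add_pos_pos add_neg_neg mult_pos_neg)
  define Z where "Z k = (\<integral>\<^sup>+ x. ext_exp (ereal k * F x) \<partial>P)" for k
  have L: "cumulant_gf P F k = ext_ln (Z k)" for k by (simp add: cumulant_gf_def Z_def)
  have zero: "Z e = 0" if "Z k = 0" "0 < k * e" for k
    using that ext_exp_eq_0_cong_sign[OF that(2)]
    unfolding Z_def by (simp add: nn_integral_0_iff_AE)
  consider "Z c = \<infinity> \<or> Z d = \<infinity>" | "Z c = 0 \<or> Z d = 0"
    | z w where "Z c = ennreal z" "0 < z" "Z d = ennreal w" "0 < w"
    by (cases "Z c"; cases "Z d") (auto simp: less_le)
  then have "ext_ln (Z e) \<le> ereal t * ext_ln (Z c) + ereal (1 - t) * ext_ln (Z d)"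
  proof cases
    case 1
    then show ?thesis using t by (auto simp: ext_ln_def)
  next
    case 2
    then have "Z e = 0" using zero ec ed by auto
    then show ?thesis by (simp add: ext_ln_def)
  next
    case 3
    define a b where "a = ln z" "b = ln w"
    let ?m = "t * a + (1 - t) * b"
    have "Z e * ennreal (exp (- ?m)) = (\<integral>\<^sup>+ x. ext_exp (ereal e * F x) * ennreal (exp (- ?m)) \<partial>P)"
      unfolding Z_def by (subst nn_integral_multc) auto
    also have "\<dots> \<le> (\<integral>\<^sup>+ x. ennreal (t * exp (- a)) * ext_exp (ereal c * F x)
        + ennreal ((1 - t) * exp (- b)) * ext_exp (ereal d * F x) \<partial>P)"
      unfolding e_def by (intro nn_integral_mono ext_exp_convex_normalized t sgn)
    also have "\<dots> = ennreal (t * exp (- a)) * Z c + ennreal ((1 - t) * exp (- b)) * Z d"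
      unfolding Z_def by (subst nn_integral_add) (auto simp: nn_integral_cmult)
    also have "\<dots> = ennreal t + ennreal (1 - t)"
      using 3 t by (simp add: a_b_def exp_minus ennreal_mult[symmetric] mult.assoc)
    also have "\<dots> = 1" using t by (simp flip: ennreal_plus)
    finally have "Z e * ennreal (exp (- ?m)) * ennreal (exp ?m) \<le> 1 * ennreal (exp ?m)"
      by (rule mult_right_mono) simp
    then have "Z e \<le> ennreal (exp ?m)"
      by (simp add: mult.assoc ennreal_mult[symmetric] exp_add[symmetric])
    from ext_ln_le_ereal[OF this] show ?thesis
      using 3 by (simp add: ext_ln_def a_b_def)
  qed
  then show ?thesis by (simp add: L e_def)
qed

text \<open>
  For \<open>n = u * x + v * y\<close>, the point \<open>inverse n\<close> is the convex combination of \<open>inverse x\<close> and \<open>inverse y\<close>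
  with weights \<open>u * x / n\<close> and \<open>v * y / n\<close>; multiplying by \<open>n\<close> turns these weights into \<open>u * x\<close> and
  \<open>v * y\<close>. The weights 0 are treated apart because the hypothesis is restricted to proper
  combinations.
\<close>
lemma ext_convex_on_perspective:
  fixes L :: "real \<Rightarrow> ereal"
  assumes conv: "\<And>t c d. 0 < t \<Longrightarrow> t < 1 \<Longrightarrow> 0 < c \<Longrightarrow> 0 < d \<Longrightarrow>
    L (t * c + (1 - t) * d) \<le> ereal t * L c + ereal (1 - t) * L d"
  shows "ext_convex_on {0<..} (\<lambda>\<eta>. ereal \<eta> * L (inverse \<eta>) + ereal \<eta> * R)"
  unfolding ext_convex_on_def
proof (intro conjI ballI allI impI)
  fix x y u v :: real
  assume xy: "x \<in> {0<..}" "y \<in> {0<..}" and uv: "0 \<le> u" "0 \<le> v" "u + v = 1"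
  let ?f = "\<lambda>\<eta>. ereal \<eta> * L (inverse \<eta>) + ereal \<eta> * R"
  consider "u = 0" "v = 1" | "u = 1" "v = 0" | "0 < u" "0 < v" using uv by force
  then show "?f (u *\<^sub>R x + v *\<^sub>R y) \<le> ereal u * ?f x + ereal v * ?f y"
  proof cases
    case 3
    define n where "n = u * x + v * y"
    define t where "t = u * x / n"
    have n: "0 < n" using xy 3 by (auto simp: n_def add_pos_pos)
    have t1: "1 - t = v * y / n" using n by (simp add: t_def n_def field_simps)
    have t: "0 < t" "0 < 1 - t" using xy 3 n unfolding t1 by (auto simp: t_def)
    have "t * inverse x + (1 - t) * inverse y = (u + v) / n"
      using xy unfolding t1 by (simp add: t_def field_simps add_divide_distrib)
    then have inv: "inverse n = t * inverse x + (1 - t) * inverse y"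
      using uv n by (simp add: field_simps)
    have "ereal n * L (inverse n) \<le> ereal n * (ereal t * L (inverse x) + ereal (1 - t) * L (inverse y))"
      unfolding inv using t xy n by (intro ereal_mult_left_mono conv) auto
    also have "\<dots> = ereal (n * t) * L (inverse x) + ereal (n * (1 - t)) * L (inverse y)"
      using n by (simp add: ereal_pos_distrib mult.assoc[symmetric])
    also have "\<dots> = ereal u * (ereal x * L (inverse x)) + ereal v * (ereal y * L (inverse y))"
      using n unfolding t1 by (simp add: t_def mult.assoc[symmetric])
    finally have le: "ereal n * L (inverse n) \<le> \<dots>" .
    have R: "ereal n * R = ereal u * (ereal x * R) + ereal v * (ereal y * R)"
      using xy uv unfolding n_def plus_ereal.simps(1)[symmetric]
      by (subst ereal_left_distrib) (auto simp: mult.assoc[symmetric])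
    have "?f n \<le> ereal u * (ereal x * L (inverse x)) + ereal v * (ereal y * L (inverse y))
        + (ereal u * (ereal x * R) + ereal v * (ereal y * R))"
      unfolding R using le by (rule add_right_mono)
    also have "\<dots> = ereal u * ?f x + ereal v * ?f y"
      using uv by (simp add: ereal_pos_distrib ac_simps)
    finally show ?thesis by (simp add: n_def)
  qed (auto simp: zero_ereal_def[symmetric])
qed simp

text \<open>
  A convex combination of two values is at most their maximum, and the reciprocal of a point between
  \<open>x\<close> and \<open>y\<close> lies between their reciprocals, with the same weights as for the perspective.
\<close>
lemma ext_quasiconvex_on_reciprocal:
  assumes "ext_convex_on {0<..} f"
  shows "ext_quasiconvex_on {0<..} (\<lambda>c::real. f (inverse c))"
  unfolding ext_quasiconvex_on_def
proof (intro conjI ballI allI impI)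
  fix x y u v :: real
  assume xy: "x \<in> {0<..}" "y \<in> {0<..}" and uv: "0 \<le> u" "0 \<le> v" "u + v = 1"
  define n where "n = u * x + v * y"
  define t where "t = u * x / n"
  have n: "0 < n" unfolding n_def
    using xy uv by (cases "u = 0") (auto intro!: add_pos_nonneg)
  have t1: "1 - t = v * y / n" using n by (simp add: t_def n_def field_simps)
  have t: "0 \<le> t" "0 \<le> 1 - t" using xy uv n unfolding t1 by (auto simp: t_def)
  have "t * inverse x + (1 - t) * inverse y = (u + v) / n"
    using xy unfolding t1 by (simp add: t_def field_simps add_divide_distrib)
  then have inv: "inverse n = t *\<^sub>R inverse x + (1 - t) *\<^sub>R inverse y"
    using uv n by (simp add: field_simps)
  let ?m = "max (f (inverse x)) (f (inverse y))"
  have "f (inverse n) \<le> ereal t * f (inverse x) + ereal (1 - t) * f (inverse y)"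
    unfolding inv using assms xy t unfolding ext_convex_on_def by auto
  also have "\<dots> \<le> ereal t * ?m + ereal (1 - t) * ?m"
    using t by (intro add_mono ereal_mult_left_mono) auto
  also have "\<dots> = (ereal t + ereal (1 - t)) * ?m"
    using t by (intro ereal_left_distrib[symmetric]) auto
  also have "\<dots> = ?m" by simp
  finally show "f (inverse (u *\<^sub>R x + v *\<^sub>R y)) \<le> ?m" by (simp add: n_def)
qed simp

section \<open>Restriction to sub sigma-algebras\<close>

lemma restr_to_subalg_trans:
  assumes "subalgebra M H" "subalgebra H G"
  shows "restr_to_subalg (restr_to_subalg M H) G = restr_to_subalg M G"
proof (rule measure_eqI)
  have HG: "subalgebra (restr_to_subalg M H) G" and MG: "subalgebra M G"
    using assms by (auto simp: subalgebra_def sets_restr_to_subalg space_restr_to_subalg)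
  show "sets (restr_to_subalg (restr_to_subalg M H) G) = sets (restr_to_subalg M G)"
    by (simp add: sets_restr_to_subalg HG MG)
  fix A assume "A \<in> sets (restr_to_subalg (restr_to_subalg M H) G)"
  then have "A \<in> sets G" by (simp add: sets_restr_to_subalg HG)
  moreover from this have "A \<in> sets H" using assms(2) by (auto simp: subalgebra_def)
  ultimately show "emeasure (restr_to_subalg (restr_to_subalg M H) G) A = emeasure (restr_to_subalg M G) A"
    by (simp add: emeasure_restr_to_subalg HG MG assms)
qed

lemma ext_expectation_restr_to_subalg:
  assumes "subalgebra M G" and [measurable]: "F \<in> borel_measurable G"
  shows "ext_expectation (restr_to_subalg M G) F = ext_expectation M F"
  unfolding ext_expectation_def by (simp add: nn_integral_subalgebra2[OF assms(1)])

text \<open>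
  The density \<open>D\<close> of the restrictions is measurable for the smaller sigma-algebra, so its integral
  under \<open>P\<close> itself is still 1, and the Gibbs inequality on the full sigma-algebra applies to it.
  Since \<open>ln D\<close> is integrated by \<open>Q\<close> and by its restriction to the same value, the left-hand side of that
  inequality is the relative entropy of the restrictions.
\<close>
lemma relative_entropy_restr_to_subalg_le:
  assumes P: "prob_space P" and Q: "prob_space Q" and sets: "sets Q = sets P"
    and sub: "subalgebra P G"
  shows "relative_entropy (restr_to_subalg Q G) (restr_to_subalg P G) \<le> relative_entropy Q P"
proof (cases "absolutely_continuous P Q")
  case False
  then show ?thesis by (simp add: relative_entropy_def)
next
  case ac: True
  let ?P = "restr_to_subalg P G" and ?Q = "restr_to_subalg Q G"
  have subQ: "subalgebra Q G"
    using sub sets sets_eq_imp_space_eq[OF sets] by (auto simp: subalgebra_def)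
  interpret P': prob_space ?P by (rule prob_space_restr_to_subalg[OF sub P])
  interpret Q': prob_space ?Q by (rule prob_space_restr_to_subalg[OF subQ Q])
  have sets': "sets ?Q = sets ?P" by (simp add: sets_restr_to_subalg sub subQ)
  have ac': "absolutely_continuous ?P ?Q"
    using ac unfolding absolutely_continuous_def
    by (auto simp: null_sets_restr_to_subalg sub subQ)
  let ?D = "RN_deriv ?P ?Q"
  have D [measurable]: "?D \<in> borel_measurable G"
    by (rule measurable_in_subalg'[OF sub]) (rule borel_measurable_RN_deriv)
  have "(\<integral>\<^sup>+ x. ?D x \<partial>P) = (\<integral>\<^sup>+ x. ?D x \<partial>?P)"
    by (rule nn_integral_subalgebra2[OF sub D, symmetric])
  also have "\<dots> = emeasure (density ?P ?D) (space ?P)"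
    by (simp add: emeasure_density cong: nn_integral_cong)
  also have "\<dots> = 1"
    using Q'.emeasure_space_1 sets_eq_imp_space_eq[OF sets']
    by (simp add: P'.density_RN_deriv[OF ac' sets'])
  finally have "ext_expectation Q (\<lambda>x. ext_ln (?D x)) \<le> relative_entropy Q P"
    by (intro gibbs_inequality P Q sets ac measurable_from_subalg[OF sub D]) auto
  then show ?thesis
    by (simp add: relative_entropy_def ac' ext_expectation_restr_to_subalg[OF subQ])
qed

section \<open>The variational bound and the monotonicity of relative entropy\<close>

theorem theorem1:
  fixes P Pt :: "'a measure" and F :: "'a \<Rightarrow> ereal"
  assumes "prob_space P" and "prob_space Pt" and "sets Pt = sets P"
  shows
    "(\<forall>G. subalgebra P G \<longrightarrow> F \<in> borel_measurable G \<longrightarrow> ext_integrable Pt F \<longrightarrow>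
        (\<forall>s\<in>{1, -1 :: real}.
           ereal s * ext_expectation Pt F
             \<le> (INF c\<in>{0<..}. ereal (1 / c) * cumulant_gf P F (s * c)
                  + ereal (1 / c) * relative_entropy (restr_to_subalg Pt G) (restr_to_subalg P G)) \<and>
           (INF c\<in>{0<..}. ereal (1 / c) * cumulant_gf P F (s * c)
                  + ereal (1 / c) * relative_entropy (restr_to_subalg Pt G) (restr_to_subalg P G))
             = (INF \<eta>\<in>{0<..}. ereal \<eta> * cumulant_gf P F (s * inverse \<eta>)
                  + ereal \<eta> * relative_entropy (restr_to_subalg Pt G) (restr_to_subalg P G)) \<and>
           ext_quasiconvex_on {0<..}
             (\<lambda>c::real. ereal (1 / c) * cumulant_gf P F (s * c)
                  + ereal (1 / c) * relative_entropy (restr_to_subalg Pt G) (restr_to_subalg P G)) \<and>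
           ext_convex_on {0<..}
             (\<lambda>\<eta>::real. ereal \<eta> * cumulant_gf P F (s * inverse \<eta>)
                  + ereal \<eta> * relative_entropy (restr_to_subalg Pt G) (restr_to_subalg P G)))) \<and>
     (\<forall>G H. subalgebra P H \<longrightarrow> subalgebra H G \<longrightarrow>
        relative_entropy (restr_to_subalg Pt G) (restr_to_subalg P G)
          \<le> relative_entropy (restr_to_subalg Pt H) (restr_to_subalg P H) \<and>
        relative_entropy (restr_to_subalg Pt H) (restr_to_subalg P H) \<le> relative_entropy Pt P)"
proof (rule conjI; intro allI impI ballI)
  have subPt: "subalgebra Pt G" if "subalgebra P G" for G
    using that assms(3) sets_eq_imp_space_eq[OF assms(3)] by (auto simp: subalgebra_def)
  {
    fix G s
    assume sub: "subalgebra P G" and F [measurable]: "F \<in> borel_measurable G"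
      and int: "ext_integrable Pt F" and s: "s \<in> {1, -1 :: real}"
    let ?P = "restr_to_subalg P G" and ?Q = "restr_to_subalg Pt G"
    let ?R = "relative_entropy ?Q ?P"
    \<comment> \<open>the objective in \<open>\<eta>\<close>; the one in \<open>c\<close> is \<open>f\<close> after \<open>inverse\<close>, so only \<open>f\<close> needs study\<close>
    define f where "f \<eta> = ereal \<eta> * cumulant_gf P F (s * inverse \<eta>) + ereal \<eta> * ?R" for \<eta> :: real
    have f_inverse: "ereal (1 / c) * cumulant_gf P F (s * c) + ereal (1 / c) * ?R = f (inverse c)" for c
      by (simp add: f_def inverse_eq_divide)
    have "ext_integrable ?Q F"
      using int measurable_in_subalg[OF subPt[OF sub] F]
      by (simp add: ext_integrable_def nn_integral_subalgebra2[OF subPt[OF sub]])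
    then have "ereal c * ext_expectation ?Q F \<le> cumulant_gf ?P F c + ?R" for c
      using sub by (intro donsker_varadhan_inequality measurable_in_subalg[OF sub F] 
         prob_space_restr_to_subalg assms subPt) (auto simp: sets_restr_to_subalg subPt)
    then have dv: "ereal c * ext_expectation Pt F \<le> cumulant_gf P F c + ?R" for c
      by (simp add: ext_expectation_restr_to_subalg subPt sub cumulant_gf_def
          nn_integral_subalgebra2[OF sub])
    have bound: "ereal s * ext_expectation Pt F \<le> f (inverse c)" if c: "0 < c" for c
    proof -
      have "ereal s * ext_expectation Pt F = ereal (inverse c) * (ereal (s * c) * ext_expectation Pt F)"
        using c by (simp add: mult.assoc[symmetric] mult.commute[of "inverse c * s"])
      also have "\<dots> \<le> ereal (inverse c) * (cumulant_gf P F (s * c) + ?R)"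
        using c by (intro ereal_mult_left_mono dv) auto
      also have "\<dots> = f (inverse c)"
        using c by (simp add: f_def ereal_pos_distrib)
      finally show ?thesis .
    qed
    have convex: "ext_convex_on {0<..} f"
      unfolding f_def
    proof (rule ext_convex_on_perspective)
      fix t c d :: real
      assume *: "0 < t" "t < 1" "0 < c" "0 < d"
      have "s * (t * c + (1 - t) * d) = t * (s * c) + (1 - t) * (s * d)"
        by (simp add: algebra_simps)
      then show "cumulant_gf P F (s * (t * c + (1 - t) * d))
          \<le> ereal t * cumulant_gf P F (s * c) + ereal (1 - t) * cumulant_gf P F (s * d)"
        using cumulant_gf_convex[OF measurable_from_subalg[OF sub F] *(1,2), of "s * c" "s * d"] * s
        by auto
    qed
    have "bij_betw inverse {0<..} {0::real<..}"
      by (rule bij_betwI[where g = inverse]) auto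
    then have "(INF c\<in>{0<..}. f (inverse c)) = (INF \<eta>\<in>{0<..}. f \<eta>)"
      using image_image[of f inverse "{0::real<..}"] by (simp add: bij_betw_def)
    moreover have le_INF: "ereal s * ext_expectation Pt F \<le> (INF c\<in>{0<..}. f (inverse c))"
      by (rule INF_greatest) (use bound in simp)
    ultimately show "ereal s * ext_expectation Pt F
             \<le> (INF c\<in>{0<..}. ereal (1 / c) * cumulant_gf P F (s * c) + ereal (1 / c) * ?R) \<and>
           (INF c\<in>{0<..}. ereal (1 / c) * cumulant_gf P F (s * c) + ereal (1 / c) * ?R)
             = (INF \<eta>\<in>{0<..}. ereal \<eta> * cumulant_gf P F (s * inverse \<eta>) + ereal \<eta> * ?R) \<and>
           ext_quasiconvex_on {0<..}
             (\<lambda>c::real. ereal (1 / c) * cumulant_gf P F (s * c) + ereal (1 / c) * ?R) \<and>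
           ext_convex_on {0<..}
             (\<lambda>\<eta>::real. ereal \<eta> * cumulant_gf P F (s * inverse \<eta>) + ereal \<eta> * ?R)"
      using le_INF convex ext_quasiconvex_on_reciprocal[OF convex]
      unfolding f_inverse f_def[symmetric] by blast
  next
    fix G H
    assume H: "subalgebra P H" and G: "subalgebra H G"
    have "subalgebra (restr_to_subalg P H) G"
      using H G by (auto simp: subalgebra_def sets_restr_to_subalg space_restr_to_subalg)
    then have "relative_entropy (restr_to_subalg (restr_to_subalg Pt H) G) (restr_to_subalg (restr_to_subalg P H) G)
        \<le> relative_entropy (restr_to_subalg Pt H) (restr_to_subalg P H)"
      using H by (intro relative_entropy_restr_to_subalg_le prob_space_restr_to_subalg assms subPt)
        (auto simp: sets_restr_to_subalg subPt)
    then show "relative_entropy (restr_to_subalg Pt G) (restr_to_subalg P G)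
          \<le> relative_entropy (restr_to_subalg Pt H) (restr_to_subalg P H) \<and>
        relative_entropy (restr_to_subalg Pt H) (restr_to_subalg P H) \<le> relative_entropy Pt P"
      using relative_entropy_restr_to_subalg_le[OF assms H]
      by (simp add: restr_to_subalg_trans[OF H G] restr_to_subalg_trans[OF subPt[OF H] G])
  }
qed

end
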